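(* Let $K=\mathbb{Q}$ and $S=\{|\cdot|_\infty,|\cdot|_2\}$, so that $R_S=\mathbb{Z}[1/2]$. There exist infinitely many ideals $\mathfrak{I}$ of $R_S$ such that there exists a $3$-cycle $(P_0,P_1,P_2)$ in $\mathbb{P}_1(\mathbb{Q})$, for a suitable rational map of degree $4$ defined over $\mathbb{Q}$ with good reduction outside $S$, for which $\mathfrak{I}(P_0,P_1)=\mathfrak{I}$.
   Context: For a prime $p$, a rational map $\Phi([x:y])=[F(x,y):G(x,y)]$ with $F,G\in\mathbb Q[x,y]$ homogeneous of the same degree without common factor has good reduction at $p$ if, after scaling so that $F,G$ have $p$-integral coefficients with at least one a $p$-adic unit, the reductions modulo $p$ have no common zero in $\mathbb P_1(\overline{\mathbb F_p})$; good reduction outside $S$ means good reduction at every odd prime. A $3$-cycle for $\Phi$ is an ordered triple of distinct points $(P_0,P_1,P_2)$ with $\Phi(P_0)=P_1,\Phi(P_1)=P_2,\Phi(P_2)=P_0$. For $P=[x_1:y_1],Q=[x_2:y_2]$, $\delta_p(P,Q)=v_p(x_1y_2-x_2y_1)-\min\{v_p(x_1),v_p(y_1)\}-\min\{v_p(x_2),v_p(y_2)\}$ and $\mathfrak I(P,Q)=\prod_{p\ne 2}p^{\delta_p(P,Q)}\cdot\mathbb Z[1/2]$. *)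

theory Defs
  imports
    "HOL-Algebra.Algebraic_Closure"
    "HOL-Number_Theory.Residues"
    "HOL-Computational_Algebra.Polynomial"
begin

section \<open>The projective line over the rationals\<close>

definition proj_rel :: "rat \<times> rat \<Rightarrow> rat \<times> rat \<Rightarrow> bool" where
  "proj_rel u v \<longleftrightarrow> u \<noteq> (0, 0) \<and> v \<noteq> (0, 0) \<and>
     (\<exists>c. c \<noteq> 0 \<and> v = (c * fst u, c * snd u))"

quotient_type p1 = "rat \<times> rat" / partial: proj_rel
proof (rule part_equivpI)
  show "\<exists>u. proj_rel u u"
    by (rule exI[of _ "(1, 0)"]) (auto simp: proj_rel_def intro: exI[of _ 1])
  show "symp proj_rel"
  proof (rule sympI)
    fix u v assume "proj_rel u v"
    then obtain c where nz: "u \<noteq> (0, 0)" "v \<noteq> (0, 0)"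
      and c: "c \<noteq> 0" "v = (c * fst u, c * snd u)"
      unfolding proj_rel_def by blast
    then have "inverse c \<noteq> 0" "u = (inverse c * fst v, inverse c * snd v)"
      by (simp_all add: prod_eq_iff)
    with nz show "proj_rel v u" unfolding proj_rel_def by blast
  qed
  show "transp proj_rel"
  proof (rule transpI)
    fix u v w assume "proj_rel u v" "proj_rel v w"
    then obtain c d where nz: "u \<noteq> (0, 0)" "w \<noteq> (0, 0)" and c: "c \<noteq> 0" "d \<noteq> 0"
      and eq: "v = (c * fst u, c * snd u)" "w = (d * fst v, d * snd v)"
      unfolding proj_rel_def by blast
    then have "d * c \<noteq> 0" "w = (d * c * fst u, d * c * snd u)" by auto
    with nz show "proj_rel u w" unfolding proj_rel_def by blast
  qed
qed

definition point :: "rat \<Rightarrow> rat \<Rightarrow> p1" where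
  "point x y = abs_p1 (x, y)"

text \<open>\<open>rep_p1 P\<close> is some choice of homogeneous coordinates of \<open>P\<close>.\<close>

lemma rep_p1_nonzero: "rep_p1 P \<noteq> (0, 0)"
  using Quotient3_rep_reflp[OF Quotient3_p1, of P] by (auto simp: proj_rel_def)

lemma point_rep_p1: "point (fst (rep_p1 P)) (snd (rep_p1 P)) = P"
  by (simp add: point_def Quotient3_abs_rep[OF Quotient3_p1])

lemma proj_rel_refl: "u \<noteq> (0, 0) \<Longrightarrow> proj_rel u u"
  by (auto simp: proj_rel_def intro!: exI[of _ 1])

lemma point_eq_iff:
  assumes "(x, y) \<noteq> (0, 0)" "(x', y') \<noteq> (0, 0)"
  shows "point x y = point x' y' \<longleftrightarrow> (\<exists>c. c \<noteq> 0 \<and> x' = c * x \<and> y' = c * y)"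
proof -
  have "point x y = point x' y' \<longleftrightarrow> proj_rel (x, y) (x', y')"
    using Quotient3_rel[OF Quotient3_p1, of "(x, y)" "(x', y')"] assms
    by (simp add: point_def proj_rel_refl)
  then show ?thesis using assms by (auto simp: proj_rel_def)
qed

lemma rep_p1_point:
  assumes "(x, y) \<noteq> (0, 0)"
  obtains c where "c \<noteq> 0" "rep_p1 (point x y) = (c * x, c * y)"
proof -
  have "(fst (rep_p1 (point x y)), snd (rep_p1 (point x y))) \<noteq> (0, 0)"
    using rep_p1_nonzero by simp
  from point_eq_iff[OF assms this] point_rep_p1[of "point x y"]
  show ?thesis using that by (metis prod.collapse)
qed

lemma point_eq_iff_det:
  assumes "(x, y) \<noteq> (0, 0)" "(x', y') \<noteq> (0, 0)"
  shows "point x y = point x' y' \<longleftrightarrow> x * y' - x' * y = 0"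
proof
  assume "point x y = point x' y'"
  then show "x * y' - x' * y = 0" using assms by (auto simp: point_eq_iff)
next
  assume det: "x * y' - x' * y = 0"
  show "point x y = point x' y'"
  proof (cases "x = 0")
    case True
    then have "x' = 0" "y \<noteq> 0" "y' \<noteq> 0" using det assms by auto
    then show ?thesis using True assms
      by (simp add: point_eq_iff) (rule exI[of _ "y' / y"], simp)
  next
    case False
    then have "x' \<noteq> 0" using det assms by auto
    then show ?thesis using False assms det
      by (simp add: point_eq_iff) (rule exI[of _ "x' / x"], simp add: field_simps)
  qed
qed

section \<open>Binary forms and rational maps\<close>

text \<open>The type \<^typ>\<open>rat poly poly\<close> is the polynomial ring \<open>\<rat>[x][y]\<close> in two variables.\<close>

definition coeff2 :: "rat poly poly \<Rightarrow> nat \<Rightarrow> nat \<Rightarrow> rat" where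
  \<comment> \<open>coefficient of \<open>x ^ i * y ^ j\<close>\<close>
  "coeff2 F i j = Polynomial.coeff (Polynomial.coeff F j) i"

definition eval2 :: "rat poly poly \<Rightarrow> rat \<Rightarrow> rat \<Rightarrow> rat" where
  "eval2 F x y = poly (poly F [:y:]) x"

definition homogeneous :: "nat \<Rightarrow> rat poly poly \<Rightarrow> bool" where
  "homogeneous d F \<longleftrightarrow> (\<forall>i j. coeff2 F i j \<noteq> 0 \<longrightarrow> i + j = d)"

definition rational_map :: "nat \<Rightarrow> rat poly poly \<Rightarrow> rat poly poly \<Rightarrow> bool" where
  "rational_map d F G \<longleftrightarrow> homogeneous d F \<and> homogeneous d G \<and> coprime F G"

definition map_apply :: "rat poly poly \<Rightarrow> rat poly poly \<Rightarrow> p1 \<Rightarrow> p1" where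
  "map_apply F G P = (let (x, y) = rep_p1 P in point (eval2 F x y) (eval2 G x y))"

definition three_cycle ::
    "rat poly poly \<Rightarrow> rat poly poly \<Rightarrow> p1 \<Rightarrow> p1 \<Rightarrow> p1 \<Rightarrow> bool" where
  "three_cycle F G P0 P1 P2 \<longleftrightarrow> P0 \<noteq> P1 \<and> P1 \<noteq> P2 \<and> P0 \<noteq> P2 \<and>
     map_apply F G P0 = P1 \<and> map_apply F G P1 = P2 \<and> map_apply F G P2 = P0"

lemma eval2_scale:
  assumes "homogeneous d F"
  shows "eval2 F (c * x) (c * y) = c ^ d * eval2 F x y"
proof -
  have e: "eval2 F a b =
      (\<Sum>j\<le>Polynomial.degree F. \<Sum>i\<le>Polynomial.degree (Polynomial.coeff F j).
         coeff2 F i j * a ^ i * b ^ j)" for a b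
  proof -
    have "eval2 F a b = (\<Sum>j\<le>Polynomial.degree F. poly (Polynomial.coeff F j) a * b ^ j)"
      by (simp add: eval2_def poly_altdef[of F] poly_sum)
    then show ?thesis
      by (simp add: coeff2_def poly_altdef[of "Polynomial.coeff F _"] sum_distrib_right)
  qed
  have t: "coeff2 F i j * (c * x) ^ i * (c * y) ^ j
      = c ^ d * (coeff2 F i j * x ^ i * y ^ j)" for i j
  proof (cases "coeff2 F i j = 0")
    case False
    then have "d = i + j" using assms by (auto simp: homogeneous_def)
    then show ?thesis by (simp add: power_add power_mult_distrib)
  qed simp
  show ?thesis unfolding e t sum_distrib_left by simp
qed

lemma map_apply_point:
  assumes "homogeneous d F" "homogeneous d G" "(x, y) \<noteq> (0, 0)"
  shows "map_apply F G (point x y) = point (eval2 F x y) (eval2 G x y)"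
proof -
  obtain c where c: "c \<noteq> 0" "rep_p1 (point x y) = (c * x, c * y)"
    using rep_p1_point[OF assms(3)] .
  have "map_apply F G (point x y) = point (c ^ d * eval2 F x y) (c ^ d * eval2 G x y)"
    by (simp add: map_apply_def c(2) eval2_scale[OF assms(1)] eval2_scale[OF assms(2)])
  also have "\<dots> = point (eval2 F x y) (eval2 G x y)"
  proof (cases "(eval2 F x y, eval2 G x y) = (0, 0)")
    case False
    then have "point (eval2 F x y) (eval2 G x y)
        = point (c ^ d * eval2 F x y) (c ^ d * eval2 G x y)"
      using c by (subst point_eq_iff) auto
    then show ?thesis ..
  qed simp
  finally show ?thesis .
qed

section \<open>Valuations and good reduction\<close>

text \<open>
  \<open>vp p r\<close> is the \<open>p\<close>-adic valuation for \<open>r \<noteq> 0\<close>. At \<open>0\<close>, where the valuation is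
  infinite, it returns the junk value \<open>0\<close>, and the definitions below treat this case separately
  where it matters.
\<close>

definition vp :: "nat \<Rightarrow> rat \<Rightarrow> int" where
  "vp p r = int (multiplicity (int p) (fst (quotient_of r)))
          - int (multiplicity (int p) (snd (quotient_of r)))"

definition p_integral :: "nat \<Rightarrow> rat \<Rightarrow> bool" where
  "p_integral p r \<longleftrightarrow> r = 0 \<or> vp p r \<ge> 0"

definition p_unit :: "nat \<Rightarrow> rat \<Rightarrow> bool" where
  "p_unit p r \<longleftrightarrow> r \<noteq> 0 \<and> vp p r = 0"

abbreviation Fp :: "nat \<Rightarrow> int ring" where
  "Fp p \<equiv> residue_ring (int p)"

abbreviation Fp_bar :: "nat \<Rightarrow> ((int list \<times> nat) multiset \<Rightarrow> int) ring" where
  "Fp_bar p \<equiv> field.alg_closure (Fp p)"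

definition reduce :: "nat \<Rightarrow> rat \<Rightarrow> int" where
  \<comment> \<open>the class in \<open>Fp p\<close> of a \<open>p\<close>-integral rational number\<close>
  "reduce p r = (let (a, b) = quotient_of r
     in (a mod int p) \<otimes>\<^bsub>Fp p\<^esub> inv\<^bsub>Fp p\<^esub> (b mod int p))"

text \<open>
  The value at \<open>(a, b)\<close> of the reduction of \<open>F\<close> modulo \<open>p\<close>. The function
  \<open>ring.indexed_const\<close> is the library's embedding of a field into its algebraic closure.
\<close>

definition eval_reduced ::
    "nat \<Rightarrow> rat poly poly \<Rightarrow> ((int list \<times> nat) multiset \<Rightarrow> int)
      \<Rightarrow> ((int list \<times> nat) multiset \<Rightarrow> int) \<Rightarrow> ((int list \<times> nat) multiset \<Rightarrow> int)" where
  "eval_reduced p F a b =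
     finsum (Fp_bar p)
       (\<lambda>(i, j). ring.indexed_const (Fp p) (reduce p (coeff2 F i j))
          \<otimes>\<^bsub>Fp_bar p\<^esub> (a [^]\<^bsub>Fp_bar p\<^esub> i \<otimes>\<^bsub>Fp_bar p\<^esub> b [^]\<^bsub>Fp_bar p\<^esub> j))
       {(i, j). coeff2 F i j \<noteq> 0}"

definition normalized_at :: "nat \<Rightarrow> rat poly poly \<Rightarrow> rat poly poly \<Rightarrow> bool" where
  "normalized_at p F G \<longleftrightarrow>
     (\<forall>i j. p_integral p (coeff2 F i j) \<and> p_integral p (coeff2 G i j)) \<and>
     (\<exists>i j. p_unit p (coeff2 F i j) \<or> p_unit p (coeff2 G i j))"

definition common_zero_mod :: "nat \<Rightarrow> rat poly poly \<Rightarrow> rat poly poly \<Rightarrow> bool" where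
  "common_zero_mod p F G \<longleftrightarrow>
     (\<exists>a \<in> carrier (Fp_bar p). \<exists>b \<in> carrier (Fp_bar p).
        (a, b) \<noteq> (\<zero>\<^bsub>Fp_bar p\<^esub>, \<zero>\<^bsub>Fp_bar p\<^esub>) \<and>
        eval_reduced p F a b = \<zero>\<^bsub>Fp_bar p\<^esub> \<and> eval_reduced p G a b = \<zero>\<^bsub>Fp_bar p\<^esub>)"

definition good_reduction :: "nat \<Rightarrow> rat poly poly \<Rightarrow> rat poly poly \<Rightarrow> bool" where
  "good_reduction p F G \<longleftrightarrow>
     (\<exists>c. c \<noteq> 0 \<and> normalized_at p (Polynomial.smult [:c:] F) (Polynomial.smult [:c:] G) \<and>
        \<not> common_zero_mod p (Polynomial.smult [:c:] F) (Polynomial.smult [:c:] G))"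

definition good_reduction_outside_2 :: "rat poly poly \<Rightarrow> rat poly poly \<Rightarrow> bool" where
  "good_reduction_outside_2 F G \<longleftrightarrow> (\<forall>p. prime p \<and> p \<noteq> 2 \<longrightarrow> good_reduction p F G)"

section \<open>The ring \<open>\<int>[1/2]\<close> and the ideals attached to pairs of points\<close>

definition R_S :: "rat ring" where
  "R_S = \<lparr>carrier = {of_int a / 2 ^ n | (a :: int) (n :: nat). True},
          monoid.mult = (*), one = 1, zero = 0, add = (+)\<rparr>"

definition min_val :: "nat \<Rightarrow> rat \<times> rat \<Rightarrow> int" where
  \<comment> \<open>a zero coordinate has infinite valuation and does not affect the minimum\<close>
  "min_val p u = Min (vp p ` ({fst u, snd u} - {0}))"

text \<open>
  For \<open>P \<noteq> Q\<close>, \<open>delta p P Q\<close> does not depend on the chosen coordinates (lemma \<open>delta_point\<close>).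
  For \<open>P = Q\<close> it is meaningless.
\<close>

definition delta :: "nat \<Rightarrow> p1 \<Rightarrow> p1 \<Rightarrow> int" where
  "delta p P Q = (let (x1, y1) = rep_p1 P; (x2, y2) = rep_p1 Q
     in vp p (x1 * y2 - x2 * y1) - min_val p (x1, y1) - min_val p (x2, y2))"

text \<open>For \<open>P \<noteq> Q\<close> only finitely many exponents are nonzero, so the product is finite.\<close>

definition ideal_of :: "p1 \<Rightarrow> p1 \<Rightarrow> rat set" where
  "ideal_of P Q =
     PIdl\<^bsub>R_S\<^esub> (\<Prod>p \<in> {p. prime p \<and> p \<noteq> 2 \<and> delta p P Q \<noteq> 0}. of_nat p powi delta p P Q)"

lemma vp_fract:
  assumes "prime p" "a \<noteq> 0" "b \<noteq> 0"
  shows "vp p (of_int a / of_int b) = int (multiplicity (int p) a) - int (multiplicity (int p) b)"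
proof -
  obtain m n where q: "quotient_of (of_int a / of_int b) = (m, n)" by fastforce
  then have n: "n > 0" using quotient_of_denom_pos by blast
  have "(of_int a / of_int b :: rat) = of_int m / of_int n" using quotient_of_div[OF q] .
  then have "(of_int (a * n) :: rat) = of_int (m * b)"
    using n assms by (simp add: field_simps)
  then have eq: "a * n = m * b" using of_int_eq_iff by blast
  then have m: "m \<noteq> 0" using assms n by auto
  have "prime_elem (int p)" using assms(1) by simp
  then have "multiplicity (int p) a + multiplicity (int p) n
      = multiplicity (int p) m + multiplicity (int p) b"
    using eq m n assms by (metis prime_elem_multiplicity_mult_distrib less_irrefl)
  then show ?thesis by (simp add: vp_def q)
qed

lemma vp_mult:
  assumes "prime p" "r \<noteq> 0" "s \<noteq> 0"
  shows "vp p (r * s) = vp p r + vp p s"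
proof -
  obtain a b c d where q: "quotient_of r = (a, b)" "quotient_of s = (c, d)" by fastforce
  then have pos: "b > 0" "d > 0" using quotient_of_denom_pos by blast+
  have r: "r = of_int a / of_int b" and s: "s = of_int c / of_int d"
    using q quotient_of_div by auto
  then have nz: "a \<noteq> 0" "c \<noteq> 0" using assms by auto
  have "r * s = of_int (a * c) / of_int (b * d)" by (simp add: r s)
  then have "vp p (r * s) = int (multiplicity (int p) (a * c)) - int (multiplicity (int p) (b * d))"
    using vp_fract[OF assms(1), of "a * c" "b * d"] nz pos by simp
  moreover have "prime_elem (int p)" using assms(1) by simp
  ultimately show ?thesis
    using nz pos by (simp add: prime_elem_multiplicity_mult_distrib vp_def q)
qed

lemma min_val_scale:
  assumes "prime p" "c \<noteq> 0" "(x, y) \<noteq> (0, 0)"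
  shows "min_val p (c * x, c * y) = vp p c + min_val p (x, y)"
  using assms by (cases "x = 0"; cases "y = 0")
    (auto simp: min_val_def vp_mult insert_Diff_if min_add_distrib_right)

lemma delta_point:
  assumes "prime p" "(x1, y1) \<noteq> (0, 0)" "(x2, y2) \<noteq> (0, 0)" "point x1 y1 \<noteq> point x2 y2"
  shows "delta p (point x1 y1) (point x2 y2)
     = vp p (x1 * y2 - x2 * y1) - min_val p (x1, y1) - min_val p (x2, y2)"
proof -
  obtain c where c: "c \<noteq> 0" "rep_p1 (point x1 y1) = (c * x1, c * y1)"
    using rep_p1_point[OF assms(2)] .
  obtain d where d: "d \<noteq> 0" "rep_p1 (point x2 y2) = (d * x2, d * y2)"
    using rep_p1_point[OF assms(3)] .
  have nz: "x1 * y2 - x2 * y1 \<noteq> 0" using assms point_eq_iff_det by blast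
  have "c * x1 * (d * y2) - d * x2 * (c * y1) = c * (d * (x1 * y2 - x2 * y1))"
    by (simp add: algebra_simps)
  then have "vp p (c * x1 * (d * y2) - d * x2 * (c * y1))
      = vp p c + (vp p d + vp p (x1 * y2 - x2 * y1))"
    using c d nz assms(1) by (simp add: vp_mult)
  then show ?thesis
    using min_val_scale[OF assms(1) c(1) assms(2)] min_val_scale[OF assms(1) d(1) assms(3)]
    by (simp add: delta_def c(2) d(2))
qed

end

theory Submission
  imports
    Defs
    "HOL-Computational_Algebra.Polynomial_Factorial"
    "HOL-Computational_Algebra.Field_as_Ring"
begin

text \<open>
  Let \<open>w = 2 ^ k\<close> and \<open>N = w\<^sup>2 + w + 1\<close>. The matrix with rows \<open>(1, -N)\<close> and \<open>(1, -(w + 1))\<close> has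
  determinant \<open>w\<^sup>2\<close>, a unit of \<open>\<int>[1/2]\<close>, and permutes the points \<open>[0:1]\<close>, \<open>[N:w+1]\<close>, \<open>[N:1]\<close>
  cyclically, and the ideal of any two of them is generated by \<open>N\<close>. To raise the degree to 4,
  multiply both linear forms of this automorphism by a cubic form \<open>q\<close> that takes unit values at the
  three points, and add to the second one a multiple of the cubic form vanishing at the three points:

  \<open>\<Phi>(x, y) = [q (x - N y) : q (x - (w + 1) y) + x\<^sup>2 (x - N y) ((w + 1) x - N y)]\<close>.

  The action on the three points is unchanged. A common zero of the two forms over a field in which
  \<open>w \<noteq> 0\<close> has \<open>x = N y\<close>, where the second form is \<open>w\<^sup>5 y\<^sup>4\<close>, or is one of the three points
  with \<open>q = 0\<close>, so there is none. The odd numbers \<open>N\<close> generate distinct ideals of \<open>\<int>[1/2]\<close>.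
\<close>

section \<open>Integral binary forms over a domain\<close>

text \<open>
  A polynomial \<open>P\<close> of degree at most \<open>d\<close> stands for the binary form \<open>x ^ d * P (y / x)\<close>, whose
  coefficient of \<open>x ^ (d - j) * y ^ j\<close> is the \<open>j\<close>-th coefficient of \<open>P\<close>.
\<close>

locale int_domain = domain R for R (structure) +
  fixes h :: "int \<Rightarrow> 'a"
  assumes h_closed [simp]: "h m \<in> carrier R"
    and h_add: "h (m + n) = h m \<oplus> h n"
    and h_mult: "h (m * n) = h m \<otimes> h n"
    and h_one [simp]: "h 1 = \<one>"
begin

lemma h_zero [simp]: "h 0 = \<zero>"
  using h_add[of 0 0] by (metis add_0 h_closed r_zero add.l_cancel zero_closed)

lemma h_uminus: "h (- m) = \<ominus> h m"
  using h_add[of "- m" m] by (metis add.left_inverse h_closed h_zero minus_equality)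

lemma h_power: "h (m ^ n) = h m [^] n"
  by (induction n) (simp_all add: h_mult m_comm)

definition eval_form :: "nat \<Rightarrow> int poly \<Rightarrow> 'a \<Rightarrow> 'a \<Rightarrow> 'a" where
  "eval_form d P a b = (\<Oplus>j\<in>{..d}. h (Polynomial.coeff P j) \<otimes> (a [^] (d - j) \<otimes> b [^] j))"

context
  fixes a b assumes a [simp]: "a \<in> carrier R" and b [simp]: "b \<in> carrier R"
begin

lemma eval_form_closed [simp]: "eval_form d P a b \<in> carrier R"
  unfolding eval_form_def by (rule finsum_closed) auto

lemma eval_form_zero [simp]: "eval_form d 0 a b = \<zero>"
  by (simp add: eval_form_def)

lemma eval_form_add: "eval_form d (P + Q) a b = eval_form d P a b \<oplus> eval_form d Q a b"
proof -
  have "eval_form d (P + Q) a b = (\<Oplus>j\<in>{..d}. h (Polynomial.coeff P j) \<otimes> (a [^] (d - j) \<otimes> b [^] j)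
      \<oplus> h (Polynomial.coeff Q j) \<otimes> (a [^] (d - j) \<otimes> b [^] j))"
    by (simp add: eval_form_def h_add l_distr)
  also have "\<dots> = eval_form d P a b \<oplus> eval_form d Q a b"
    unfolding eval_form_def by (rule finsum_addf) auto
  finally show ?thesis .
qed

lemma eval_form_smult: "eval_form d (Polynomial.smult r P) a b = h r \<otimes> eval_form d P a b"
  by (simp add: eval_form_def h_mult m_assoc finsum_rdistr)

text \<open>A larger formal degree contributes powers of the first variable; this is the source of
  the factor x^2 in the second form of the map.\<close>

lemma eval_form_raise:
  assumes "Polynomial.degree P \<le> d"
  shows "eval_form (e + d) P a b = a [^] e \<otimes> eval_form d P a b"
proof -
  have "eval_form (e + d) P a b
      = (\<Oplus>j\<in>{..d}. h (Polynomial.coeff P j) \<otimes> (a [^] (e + d - j) \<otimes> b [^] j))"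
    unfolding eval_form_def using assms
    by (intro add.finprod_mono_neutral_cong_right) (auto simp: coeff_eq_0)
  also have "\<dots> = (\<Oplus>j\<in>{..d}. a [^] e \<otimes> (h (Polynomial.coeff P j) \<otimes> (a [^] (d - j) \<otimes> b [^] j)))"
    by (intro add.finprod_cong')
      (auto simp: nat_pow_mult m_ac simp flip: Nat.add_diff_assoc nat_pow_mult)
  also have "\<dots> = a [^] e \<otimes> eval_form d P a b"
    unfolding eval_form_def by (rule finsum_rdistr[symmetric]) auto
  finally show ?thesis .
qed

text \<open>A Horner step in the second variable, which opens the way to induction on the
  coefficients.\<close>

lemma eval_form_pCons:
  "eval_form (Suc d) (pCons r P) a b = h r \<otimes> a [^] Suc d \<oplus> b \<otimes> eval_form d P a b"
proof -
  have "eval_form (Suc d) (pCons r P) a b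
     = h r \<otimes> a [^] Suc d \<oplus> (\<Oplus>j\<in>{..d}. h (Polynomial.coeff P j) \<otimes> (a [^] (d - j) \<otimes> b [^] Suc j))"
    unfolding eval_form_def by (subst finsum_Suc2) (auto simp: a_comm simp del: nat_pow_Suc)
  also have "(\<Oplus>j\<in>{..d}. h (Polynomial.coeff P j) \<otimes> (a [^] (d - j) \<otimes> b [^] Suc j))
     = (\<Oplus>j\<in>{..d}. b \<otimes> (h (Polynomial.coeff P j) \<otimes> (a [^] (d - j) \<otimes> b [^] j)))"
    by (intro add.finprod_cong') (auto simp: m_ac)
  also have "\<dots> = b \<otimes> eval_form d P a b"
    unfolding eval_form_def by (rule finsum_rdistr[symmetric]) auto
  finally show ?thesis .
qed

text \<open>Induction on \<open>P\<close> with \<open>d\<close> free, since removing the constant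
  coefficient lowers the degree by one. That coefficient multiplies \<open>Q\<close> read as a form
  of larger degree, hence the appeal to \<open>eval_form_raise\<close>.\<close>

lemma eval_form_mult:
  assumes "Polynomial.degree P \<le> d" "Polynomial.degree Q \<le> e"
  shows "eval_form (d + e) (P * Q) a b = eval_form d P a b \<otimes> eval_form e Q a b"
  using assms(1)
proof (induction P arbitrary: d)
  case 0
  then show ?case by simp
next
  case (pCons r P)
  show ?case
  proof (cases d)
    case 0
    with pCons have "P = 0" by (auto split: if_splits)
    moreover have "eval_form 0 [:r:] a b = h r"
      by (simp add: eval_form_def)
    ultimately show ?thesis using 0 by (simp add: eval_form_smult)
  next
    case (Suc k)
    with pCons have P: "Polynomial.degree P \<le> k" by (auto split: if_splits)
    have "eval_form (d + e) (pCons r P * Q) a b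
        = h r \<otimes> eval_form (Suc k + e) Q a b \<oplus> eval_form (Suc (k + e)) (pCons 0 (P * Q)) a b"
      by (simp add: Suc eval_form_add eval_form_smult)
    also have "\<dots> = h r \<otimes> (a [^] Suc k \<otimes> eval_form e Q a b)
        \<oplus> b \<otimes> (eval_form k P a b \<otimes> eval_form e Q a b)"
      unfolding eval_form_raise[OF assms(2)] eval_form_pCons pCons.IH[OF P] by simp
    also have "\<dots> = eval_form d (pCons r P) a b \<otimes> eval_form e Q a b"
      unfolding Suc eval_form_pCons by (simp add: l_distr m_assoc del: nat_pow_Suc)
    finally show ?thesis .
  qed
qed

lemma eval_form_linear: "eval_form 1 [:r, s:] a b = h r \<otimes> a \<oplus> h s \<otimes> b"
  using eval_form_pCons[of 0 r "[:s:]"] by (simp add: eval_form_def m_comm)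

end

text \<open>Homogeneity turns vanishing at a multiple of an integer point into a computation with
  integers.\<close>

lemma eval_form_int:
  assumes [simp]: "t \<in> carrier R"
  shows "eval_form d P (h r \<otimes> t) (h s \<otimes> t)
    = h (\<Sum>j\<le>d. Polynomial.coeff P j * r ^ (d - j) * s ^ j) \<otimes> t [^] d"
proof -
  have h_sum: "h (\<Sum>j\<le>k. f j) = (\<Oplus>j\<in>{..k}. h (f j))" for f and k :: nat
    by (induction k) (simp_all add: h_add a_comm)
  have "eval_form d P (h r \<otimes> t) (h s \<otimes> t)
      = (\<Oplus>j\<in>{..d}. h (Polynomial.coeff P j * r ^ (d - j) * s ^ j) \<otimes> t [^] d)"
    unfolding eval_form_def
  proof (intro add.finprod_cong' refl)
    fix j assume "j \<in> {..d}"
    then have "t [^] d = t [^] (d - j) \<otimes> t [^] j"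
      by (simp add: nat_pow_mult)
    then show "h (Polynomial.coeff P j) \<otimes> ((h r \<otimes> t) [^] (d - j) \<otimes> (h s \<otimes> t) [^] j)
        = h (Polynomial.coeff P j * r ^ (d - j) * s ^ j) \<otimes> t [^] d"
      by (simp add: h_mult h_power nat_pow_distrib m_ac)
  qed auto
  then show ?thesis by (simp add: finsum_ldistr h_sum)
qed

end

section \<open>The family of quartic maps\<close>

text \<open>
  The coefficients interpolate the values \<open>1\<close>, \<open>- w ^ 3\<close>, \<open>w ^ 3\<close> at \<open>(0, 1)\<close>, \<open>(N, w + 1)\<close>,
  \<open>(N, 1)\<close>. Integral interpolation imposes congruences modulo \<open>N\<^sup>2\<close> on these values, which the
  powers of \<open>w\<close> satisfy because \<open>w ^ 3 = 1 + (w - 1) * N\<close>.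
\<close>

definition cubic_factor :: "int \<Rightarrow> int poly" where
  "cubic_factor w = [:1, - (w + 1)\<^sup>2, w ^ 3 + w\<^sup>2 + 2 * w - 1, 1:]"

definition numer :: "int \<Rightarrow> int poly" where
  "numer w = cubic_factor w * [:1, - (w\<^sup>2 + w + 1):]"

text \<open>The second summand has degree 2 only; read as a quartic form it gains x^2.\<close>

definition denom :: "int \<Rightarrow> int poly" where
  "denom w = cubic_factor w * [:1, - (w + 1):]
     + [:1, - (w\<^sup>2 + w + 1):] * [:w + 1, - (w\<^sup>2 + w + 1):]"

section \<open>Values on the cycle and absence of common zeros\<close>

lemma degree_cubic_factor: "Polynomial.degree (cubic_factor w) \<le> 3"
  by (simp add: cubic_factor_def)

lemma cubic_factor_values:
  "(\<Sum>j\<le>3. Polynomial.coeff (cubic_factor w) j * 0 ^ (3 - j) * 1 ^ j) = 1"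
  "(\<Sum>j\<le>3. Polynomial.coeff (cubic_factor w) j * (w\<^sup>2 + w + 1) ^ (3 - j) * (w + 1) ^ j) = - (w ^ 3)"
  by (simp_all add: cubic_factor_def numeral_eq_Suc algebra_simps)

text \<open>At (N, 1) the added term vanishes, the cubic factor is w^3 and the linear form is N - (w
  + 1) = w^2.\<close>

lemma denom_value:
  "(\<Sum>j\<le>4. Polynomial.coeff (denom w) j * (w\<^sup>2 + w + 1) ^ (4 - j) * 1 ^ j) = w ^ 5"
  by (simp add: denom_def cubic_factor_def numeral_eq_Suc algebra_simps)

lemma (in int_domain) no_common_zero:
  assumes w: "h w \<noteq> \<zero>" and ab [simp]: "a \<in> carrier R" "b \<in> carrier R"
    and F: "eval_form 4 (numer w) a b = \<zero>" and G: "eval_form 4 (denom w) a b = \<zero>"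
  shows "a = \<zero> \<and> b = \<zero>"
proof -
  define N where "N = w\<^sup>2 + w + 1"
  let ?q = "eval_form 3 (cubic_factor w) a b"
  let ?l = "eval_form 1 [:1, - N:] a b"
  let ?k = "eval_form 1 [:w + 1, - N:] a b"
  have w_pow: "h w [^] n \<noteq> \<zero>" for n :: nat
    by (induction n) (use w in \<open>simp_all add: integral_iff\<close>)
  have pow_zero: "t = \<zero>" if "t [^] n = \<zero>" "t \<in> carrier R" for t and n :: nat
    using that by (induction n) (auto simp: integral_iff)
  \<comment> \<open>On this line (a, b) is \<open>b\<close> times (N, 1), where \<open>denom\<close>
    takes the value w^5. Both branches of the later case split come back to it.\<close>
  have case_l: ?thesis if "?l = \<zero>"
  proof -
    have a: "a = h N \<otimes> b"
      using that unfolding eval_form_linear[OF ab] by (simp add: h_uminus l_minus flip: minus_eq)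
    have "eval_form 4 (denom w) (h N \<otimes> b) (h 1 \<otimes> b) = h (w ^ 5) \<otimes> b [^] (4::nat)"
      unfolding eval_form_int[OF ab(2)] N_def denom_value ..
    with G a have "h w [^] (5::nat) \<otimes> b [^] (4::nat) = \<zero>"
      by (simp add: h_power)
    then have "b = \<zero>"
      using w_pow[of 5] pow_zero[of b 4] by (simp add: integral_iff)
    with a show ?thesis by simp
  qed
  have "eval_form (3 + 1) (numer w) a b = ?q \<otimes> ?l"
    unfolding numer_def N_def by (rule eval_form_mult) (simp_all add: degree_cubic_factor)
  then have "?q \<otimes> ?l = \<zero>"
    using F by simp
  then consider "?q = \<zero>" | "?l = \<zero>"
    using integral[OF _ eval_form_closed[OF ab] eval_form_closed[OF ab]] by blast
  then show ?thesis
  proof cases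
    case 1
    \<comment> \<open>When \<open>?q\<close> vanishes, only the added term of \<open>denom\<close>
      survives; writing 4 as 2 + (1 + 1) exhibits its factors.\<close>
    have "eval_form (3 + 1) (cubic_factor w * [:1, - (w + 1):]) a b
        = ?q \<otimes> eval_form 1 [:1, - (w + 1):] a b"
      by (rule eval_form_mult) (simp_all add: degree_cubic_factor)
    moreover have "eval_form (2 + (1 + 1)) ([:1, - N:] * [:w + 1, - N:]) a b
        = a [^] (2::nat) \<otimes> eval_form (1 + 1) ([:1, - N:] * [:w + 1, - N:]) a b"
      by (rule eval_form_raise) simp_all
    moreover have "eval_form (1 + 1) ([:1, - N:] * [:w + 1, - N:]) a b = ?l \<otimes> ?k"
      by (rule eval_form_mult) simp_all
    ultimately have "eval_form 4 (denom w) a b = a [^] (2::nat) \<otimes> (?l \<otimes> ?k)"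
      using 1 unfolding denom_def eval_form_add[OF ab] N_def[symmetric]
      by (simp add: numeral_eq_Suc del: mult_pCons_left mult_pCons_right)
    then have "a [^] (2::nat) \<otimes> (?l \<otimes> ?k) = \<zero>"
      using G by simp
    then have "a [^] (2::nat) = \<zero> \<or> ?l = \<zero> \<or> ?k = \<zero>"
      using integral_iff nat_pow_closed m_closed eval_form_closed ab by metis
    then consider "a = \<zero>" | "?l = \<zero>" | "?k = \<zero>"
      using pow_zero[OF _ ab(1)] by blast
    then show ?thesis
    proof cases
      case 1
      have "eval_form 3 (cubic_factor w) (h 0 \<otimes> b) (h 1 \<otimes> b) = h 1 \<otimes> b [^] (3::nat)"
        unfolding eval_form_int[OF ab(2)] cubic_factor_values ..
      with 1 \<open>?q = \<zero>\<close> pow_zero[of b 3] show ?thesis by simp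
    next
      case 2
      then show ?thesis by (rule case_l)
    next
      case 3
      \<comment> \<open>Since N - w (w + 1) = 1, the line \<open>?k = \<zero>\<close> consists of
        the multiples of (N, w + 1), and \<open>t\<close> recovers the multiplier without
        division.\<close>
      define t where "t = a \<oplus> h (- w) \<otimes> b"
      have t [simp]: "t \<in> carrier R" by (simp add: t_def)
      have k: "h (w + 1) \<otimes> a = h N \<otimes> b"
        using 3 unfolding eval_form_linear[OF ab] by (simp add: h_uminus l_minus flip: minus_eq)
      have one: "h N \<oplus> h (- w) \<otimes> h (w + 1) = \<one>"
        by (simp add: N_def power2_eq_square algebra_simps flip: h_add h_mult)
      have "h N \<otimes> t = h N \<otimes> a \<oplus> h (- w) \<otimes> (h N \<otimes> b)"
        by (simp add: t_def r_distr m_lcomm)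
      also have "\<dots> = (h N \<oplus> h (- w) \<otimes> h (w + 1)) \<otimes> a"
        unfolding k[symmetric] by (simp only: l_distr m_assoc h_closed m_closed ab)
      finally have a: "a = h N \<otimes> t" by (simp only: one l_one ab)
      have "h (w + 1) \<otimes> t = h (w + 1) \<otimes> a \<oplus> h (- w) \<otimes> h (w + 1) \<otimes> b"
        by (simp add: t_def r_distr m_assoc m_lcomm)
      also have "\<dots> = (h N \<oplus> h (- w) \<otimes> h (w + 1)) \<otimes> b"
        unfolding k by (simp only: l_distr h_closed m_closed ab)
      finally have b: "b = h (w + 1) \<otimes> t" by (simp only: one l_one ab)
      have "eval_form 3 (cubic_factor w) (h N \<otimes> t) (h (w + 1) \<otimes> t) = h (- (w ^ 3)) \<otimes> t [^] (3::nat)"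
        unfolding eval_form_int[OF t] N_def cubic_factor_values ..
      with \<open>?q = \<zero>\<close> a b have "h w [^] (3::nat) \<otimes> t [^] (3::nat) = \<zero>"
        by (simp add: h_uminus h_power l_minus)
      then have "t = \<zero>"
        using w_pow[of 3] pow_zero[of t 3] by (simp add: integral_iff)
      with a b show ?thesis by simp
    qed
  qed (rule case_l)
qed

section \<open>Integer polynomials as binary forms over the rationals\<close>

definition homogenize :: "nat \<Rightarrow> int poly \<Rightarrow> rat poly poly" where
  "homogenize d P = (\<Sum>j\<le>d. monom (monom (of_int (Polynomial.coeff P j)) (d - j)) j)"

lemma coeff2_homogenize:
  "coeff2 (homogenize d P) i j = (if i + j = d then of_int (Polynomial.coeff P j) else 0)"
proof -
  have "coeff2 (homogenize d P) i j
      = (\<Sum>k\<le>d. if k = j then (if d - k = i then of_int (Polynomial.coeff P k) else 0) else 0)"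
    by (auto simp: coeff2_def homogenize_def coeff_sum intro!: sum.cong)
  then show ?thesis by (auto simp: sum.delta)
qed

lemma homogeneous_homogenize: "homogeneous d (homogenize d P)"
  by (simp add: homogeneous_def coeff2_homogenize)

lemma eval2_homogenize:
  "eval2 (homogenize d P) x y = (\<Sum>j\<le>d. of_int (Polynomial.coeff P j) * x ^ (d - j) * y ^ j)"
  by (simp add: eval2_def homogenize_def poly_sum poly_monom)

section \<open>Good reduction\<close>

text \<open>Injectivity of the embedding of \<open>Fp p\<close> into its closure keeps nonzero
  residues nonzero.\<close>

lemma Fp_bar_int_domain:
  assumes "prime p"
  shows "int_domain (Fp_bar p) (\<lambda>n. ring.indexed_const (Fp p) (n mod int p))"
    and "\<not> int p dvd n \<Longrightarrow> ring.indexed_const (Fp p) (n mod int p) \<noteq> \<zero>\<^bsub>Fp_bar p\<^esub>"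
proof -
  interpret residues_prime p "Fp p" by (simp_all add: residues_prime.intro assms)
  interpret L: field "Fp_bar p"
    using alg_closureE(1) by (simp add: algebraic_closure_def)
  interpret ring_hom_ring "Fp p" "Fp_bar p" indexed_const
    using alg_closureE(2) by unfold_locales
  have c: "n mod int p \<in> carrier (Fp p)" for n
    using m_gt_one by (simp add: res_carrier_eq)
  show "int_domain (Fp_bar p) (\<lambda>n. indexed_const (n mod int p))"
  proof
    fix m n :: int
    show "indexed_const (m mod int p) \<in> carrier (Fp_bar p)"
      using c by simp
    show "indexed_const ((m + n) mod int p)
        = indexed_const (m mod int p) \<oplus>\<^bsub>Fp_bar p\<^esub> indexed_const (n mod int p)"
      using hom_add[OF c c, of m n] by (simp add: res_add_eq mod_add_eq)
    show "indexed_const ((m * n) mod int p)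
        = indexed_const (m mod int p) \<otimes>\<^bsub>Fp_bar p\<^esub> indexed_const (n mod int p)"
      using hom_mult[OF c c, of m n] by (simp add: res_mult_eq mod_mult_eq)
    show "indexed_const (1 mod int p) = \<one>\<^bsub>Fp_bar p\<^esub>"
      using hom_one m_gt_one by (simp add: res_one_eq)
  qed
  assume n: "\<not> int p dvd n"
  show "indexed_const (n mod int p) \<noteq> \<zero>\<^bsub>Fp_bar p\<^esub>"
  proof
    assume "indexed_const (n mod int p) = \<zero>\<^bsub>Fp_bar p\<^esub>"
    then have "n mod int p = \<zero>\<^bsub>Fp p\<^esub>"
      using hom_zero by (metis injD[OF indexed_const_is_inj])
    with n show False by (auto simp: res_zero_eq)
  qed
qed

lemma reduce_of_int:
  assumes "prime p"
  shows "reduce p (of_int n) = n mod int p"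
proof -
  interpret residues_prime p "Fp p" by (simp_all add: residues_prime.intro assms)
  have "1 mod int p = \<one>\<^bsub>Fp p\<^esub>" using m_gt_one by (simp add: res_one_eq)
  then have "inv\<^bsub>Fp p\<^esub> (1 mod int p) = 1"
    using inv_one res_one_eq by metis
  then show ?thesis by (simp add: reduce_def res_mult_eq)
qed

lemma eval_reduced_homogenize:
  assumes "prime p" "a \<in> carrier (Fp_bar p)" "b \<in> carrier (Fp_bar p)"
  shows "eval_reduced p (homogenize d P) a b
    = int_domain.eval_form (Fp_bar p) (\<lambda>n. ring.indexed_const (Fp p) (n mod int p)) d P a b"
proof -
  let ?h = "\<lambda>n. ring.indexed_const (Fp p) (n mod int p)"
  interpret int_domain "Fp_bar p" ?h
    by (rule Fp_bar_int_domain[OF assms(1)])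
  let ?A = "{(i, j). coeff2 (homogenize d P) i j \<noteq> 0}"
  define f where "f = (\<lambda>(i :: nat, j). ?h (Polynomial.coeff P j)
      \<otimes>\<^bsub>Fp_bar p\<^esub> (a [^]\<^bsub>Fp_bar p\<^esub> i \<otimes>\<^bsub>Fp_bar p\<^esub> b [^]\<^bsub>Fp_bar p\<^esub> j))"
  have f: "f \<in> UNIV \<rightarrow> carrier (Fp_bar p)"
    using assms(2,3) h_closed by (auto simp: f_def)
  have "eval_reduced p (homogenize d P) a b = finsum (Fp_bar p) f ?A"
    unfolding eval_reduced_def
    by (rule add.finprod_cong')
      (use assms(2,3) h_closed in
        \<open>auto simp: f_def coeff2_homogenize reduce_of_int[OF assms(1)] split: if_splits\<close>)
  \<comment> \<open>The support is enlarged to all exponent pairs of total degree \<open>d\<close>;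
    the new terms have coefficient 0.\<close>
  also have "\<dots> = finsum (Fp_bar p) f ((\<lambda>j. (d - j, j)) ` {..d})"
  proof (rule add.finprod_mono_neutral_cong_left)
    show "?A \<subseteq> (\<lambda>j. (d - j, j)) ` {..d}"
      by (force simp: coeff2_homogenize split: if_splits)
    show "f x = \<zero>\<^bsub>Fp_bar p\<^esub>" if "x \<in> (\<lambda>j. (d - j, j)) ` {..d} - ?A" for x
      using that assms(2,3) h_zero by (auto simp: f_def coeff2_homogenize)
  qed (use f in auto)
  also have "\<dots> = finsum (Fp_bar p) (\<lambda>j. f (d - j, j)) {..d}"
    by (rule add.finprod_reindex) (use f in \<open>auto simp: inj_on_def\<close>)
  finally show ?thesis
    by (simp add: f_def eval_form_def)
qed

lemma good_reduction_family:
  assumes "prime p" "\<not> int p dvd w"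
  shows "good_reduction p (homogenize 4 (numer w)) (homogenize 4 (denom w))"
proof -
  let ?F = "homogenize 4 (numer w)" and ?G = "homogenize 4 (denom w)"
  interpret int_domain "Fp_bar p" "\<lambda>n. ring.indexed_const (Fp p) (n mod int p)"
    by (rule Fp_bar_int_domain[OF assms(1)])
  have integral: "p_integral p (of_int n)" for n
    by (simp add: p_integral_def vp_def)
  \<comment> \<open>The coefficient 1 of x^4 makes this integral pair normalized at every prime, so
    the scalar can be 1.\<close>
  have "coeff2 ?F 4 0 = 1"
    by (simp add: coeff2_homogenize numer_def cubic_factor_def)
  then have "p_unit p (coeff2 ?F 4 0)"
    by (simp add: p_unit_def vp_def)
  moreover have "p_integral p (coeff2 ?F i j) \<and> p_integral p (coeff2 ?G i j)" for i j
    using integral integral[of 0] by (simp add: coeff2_homogenize)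
  ultimately have "normalized_at p ?F ?G"
    unfolding normalized_at_def by blast
  moreover have "\<not> common_zero_mod p ?F ?G"
  proof
    assume "common_zero_mod p ?F ?G"
    then obtain a b where ab: "a \<in> carrier (Fp_bar p)" "b \<in> carrier (Fp_bar p)"
        "(a, b) \<noteq> (\<zero>\<^bsub>Fp_bar p\<^esub>, \<zero>\<^bsub>Fp_bar p\<^esub>)"
      and "eval_form 4 (numer w) a b = \<zero>\<^bsub>Fp_bar p\<^esub>" "eval_form 4 (denom w) a b = \<zero>\<^bsub>Fp_bar p\<^esub>"
      unfolding common_zero_mod_def using eval_reduced_homogenize[OF assms(1)] by metis
    then show False
      using no_common_zero[OF Fp_bar_int_domain(2)[OF assms] ab(1,2)] by blast
  qed
  ultimately show ?thesis
    unfolding good_reduction_def by (intro exI[of _ 1]) (simp flip: one_pCons)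
qed

section \<open>Coprimality\<close>

lemma monom_monom_of_int:
  "monom (monom (of_int c :: rat) i) j = of_int c * [:[:0, 1:]:] ^ i * [:0, 1:] ^ j"
proof -
  have "[:x:] ^ i = [:x ^ i:]" for x :: "rat poly"
    by (induction i) (simp_all add: one_pCons)
  then show ?thesis by (simp add: monom_altdef of_int_poly)
qed

text \<open>One Euclidean step: coprimality passes from the remainder to the dividend.\<close>

lemma coprime_add_multiple:
  fixes a b c :: "'a :: {comm_ring_1, algebraic_semidom}"
  assumes "coprime a c" "b = a * r + c"
  shows "coprime a b"
proof (rule coprimeI)
  fix u assume "u dvd a" "u dvd b"
  then have "u dvd b - a * r" by (intro dvd_diff) auto
  then have "u dvd c" by (simp add: assms(2))
  with \<open>u dvd a\<close> show "is_unit u" using assms(1) coprime_common_divisor by blast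
qed

text \<open>A divisor of x is constant in y, and a constant dividing y divides its coefficient
  1.\<close>

lemma coprime_variables: "coprime [:[:0, 1:]:] ([:0, 1:] :: rat poly poly)"
proof (rule coprimeI)
  fix u :: "rat poly poly" assume u: "u dvd [:[:0, 1:]:]" "u dvd [:0, 1:]"
  then have "degree u \<le> degree [:[:0, 1::rat:]:]"
    by (intro dvd_imp_degree_le) auto
  then obtain c where c: "u = [:c:]" using degree_eq_zeroE by auto
  then have "c dvd coeff [:0, 1 :: rat poly:] 1"
    using u(2) const_poly_dvd_iff by blast
  then show "is_unit u" using c by (simp add: is_unit_const_poly_iff)
qed

text \<open>For the forms \<open>q * l\<close> and q m + x^2 l k it suffices that \<open>q\<close>
  is coprime to \<open>x\<close>, \<open>l\<close>, \<open>k\<close>, and \<open>l\<close> to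
  \<open>m\<close>. Up to sign, each Euclidean remainder is a power of the unit \<open>W\<close>
  times a power of \<open>y\<close> or \<open>t\<close>.\<close>

lemma coprime_family:
  assumes "w \<noteq> 0"
  shows "coprime (homogenize 4 (numer w)) (homogenize 4 (denom w))"
proof -
  define x :: "rat poly poly" where "x = [:[:0, 1:]:]"
  define y :: "rat poly poly" where "y = [:0, 1:]"
  define W :: "rat poly poly" where "W = of_int w"
  define N where "N = W\<^sup>2 + W + 1"
  define q where "q = x ^ 3 - (W + 1)\<^sup>2 * x\<^sup>2 * y + (W ^ 3 + W\<^sup>2 + 2 * W - 1) * x * y\<^sup>2 + y ^ 3"
  define l where "l = x - N * y"
  define m where "m = x - (W + 1) * y"
  define k where "k = (W + 1) * x - N * y"
  define t where "t = x - W * y"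
  note defs = N_def q_def l_def m_def k_def t_def
  have F: "homogenize 4 (numer w) = q * l"
    unfolding homogenize_def monom_monom_of_int x_def[symmetric] y_def[symmetric]
    by (simp add: numer_def cubic_factor_def numeral_eq_Suc defs W_def algebra_simps)
  have G: "homogenize 4 (denom w) = q * m + x\<^sup>2 * (l * k)"
    unfolding homogenize_def monom_monom_of_int x_def[symmetric] y_def[symmetric]
    by (simp add: denom_def cubic_factor_def numeral_eq_Suc defs W_def algebra_simps)
  have "is_unit W"
    using assms by (simp add: W_def of_int_poly is_unit_const_poly_iff dvd_field_iff)
  then have W: "coprime u W" for u
    by (rule is_unit_right_imp_coprime)
  have xy: "coprime x y"
    using coprime_variables by (simp add: x_def y_def)
  have ly: "coprime l y"
    by (subst coprime_commute, rule coprime_add_multiple[of _ x _ "- N"])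
      (use xy in \<open>simp_all add: l_def coprime_commute\<close>)
  have lq: "coprime l q"
  proof (rule coprime_add_multiple)
    show "coprime l (W ^ 3 * y ^ 3)" using ly W by simp
    show "q = l * (x\<^sup>2 - W * x * y + (W - 1) * y\<^sup>2) + W ^ 3 * y ^ 3"
      by (simp add: defs power2_eq_square power3_eq_cube algebra_simps)
  qed
  have lm: "coprime l m"
  proof (rule coprime_add_multiple)
    show "coprime l (W\<^sup>2 * y)" using ly W by simp
    show "m = l * 1 + W\<^sup>2 * y" by (simp add: defs algebra_simps)
  qed
  have xq: "coprime x q"
  proof (rule coprime_add_multiple)
    show "coprime x (y ^ 3)" using xy by simp
    show "q = x * (x\<^sup>2 - (W + 1)\<^sup>2 * x * y + (W ^ 3 + W\<^sup>2 + 2 * W - 1) * y\<^sup>2) + y ^ 3"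
      by (simp add: defs power2_eq_square power3_eq_cube algebra_simps)
  qed
  \<comment> \<open>\<open>k\<close> and \<open>t\<close> arise from \<open>x\<close> and
    \<open>y\<close> by a matrix of determinant N - W (W + 1) = 1; its inverse gives the two
    combinations.\<close>
  have kt: "coprime k t"
  proof (rule coprimeI)
    fix u assume "u dvd k" "u dvd t"
    then have "u dvd N * t - W * k" "u dvd (W + 1) * t - k" by auto
    moreover have "N * t - W * k = x" "(W + 1) * t - k = y"
      by (simp_all add: defs power2_eq_square algebra_simps)
    ultimately show "is_unit u" using xy coprime_common_divisor by metis
  qed
  \<comment> \<open>The remainder matches the value -w^3 of \<open>q\<close> at (N, w + 1), a point
    of the line \<open>k = 0\<close> where \<open>t\<close> is 1.\<close>
  have kq: "coprime k q"
  proof (rule coprime_add_multiple)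
    show "coprime k (- (W ^ 3 * t ^ 3))" using kt W by simp
    show "q = k * ((W\<^sup>2 - W + 1) * x\<^sup>2 - 2 * W * (W\<^sup>2 - W + 1) * x * y + (W ^ 3 + 1) * (W - 1) * y\<^sup>2)
        + - (W ^ 3 * t ^ 3)"
      by (simp add: defs power2_eq_square power3_eq_cube algebra_simps)
  qed
  have "coprime q (x\<^sup>2 * (l * k))"
    using xq lq kq by (simp add: coprime_commute)
  then have "coprime q (q * m + x\<^sup>2 * (l * k))"
    by (rule coprime_add_multiple) (rule refl)
  moreover have "coprime l (q * m + x\<^sup>2 * (l * k))"
  proof (rule coprime_add_multiple)
    show "coprime l (q * m)" using lq lm by simp
    show "q * m + x\<^sup>2 * (l * k) = l * (x\<^sup>2 * k) + q * m" by (simp add: algebra_simps)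
  qed
  ultimately show ?thesis unfolding F G by simp
qed

section \<open>The cycle and its ideal\<close>

lemma eval2_family:
  fixes w :: int and x y :: rat
  defines "q \<equiv> x ^ 3 - (of_int w + 1)\<^sup>2 * x\<^sup>2 * y
      + (of_int w ^ 3 + (of_int w)\<^sup>2 + 2 * of_int w - 1) * x * y\<^sup>2 + y ^ 3"
    and "N \<equiv> (of_int w)\<^sup>2 + of_int w + 1"
  shows "eval2 (homogenize 4 (numer w)) x y = q * (x - N * y)"
    and "eval2 (homogenize 4 (denom w)) x y = q * (x - (of_int w + 1) * y)
      + x\<^sup>2 * (x - N * y) * ((of_int w + 1) * x - N * y)"
  by (simp_all add: eval2_homogenize numer_def denom_def cubic_factor_def numeral_eq_Suc
      q_def N_def algebra_simps)

lemma three_cycle_family: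
  fixes w :: int
  assumes "w > 0"
  defines "N \<equiv> (of_int w)\<^sup>2 + of_int w + 1 :: rat"
  shows "three_cycle (homogenize 4 (numer w)) (homogenize 4 (denom w))
    (point 0 1) (point N (of_int w + 1)) (point N 1)"
proof -
  let ?W = "of_int w :: rat"
  let ?F = "homogenize 4 (numer w)" and ?G = "homogenize 4 (denom w)"
  note map = map_apply_point[OF homogeneous_homogenize homogeneous_homogenize, of _ _ 4]
  have W: "?W > 0" using assms by simp
  have N: "N > 0" using W by (simp add: N_def add_pos_pos)
  have "eval2 ?F 0 1 = - N" "eval2 ?G 0 1 = - (?W + 1)"
    by (simp_all add: eval2_family N_def)
  then have 0: "map_apply ?F ?G (point 0 1) = point N (?W + 1)"
    using N W by (simp add: map point_eq_iff) (rule exI[of _ "- 1"], simp)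
  \<comment> \<open>Here q is -w^3 and the two linear forms are -w N and -w; the added term vanishes
    at all three points.\<close>
  have "eval2 ?F N (?W + 1) = ?W ^ 4 * N" "eval2 ?G N (?W + 1) = ?W ^ 4"
    by (simp_all add: eval2_family N_def power2_eq_square power3_eq_cube power4_eq_xxxx algebra_simps)
  then have 1: "map_apply ?F ?G (point N (?W + 1)) = point N 1"
    using N W by (simp add: map point_eq_iff_det)
  have "eval2 ?F N 1 = 0" "eval2 ?G N 1 = ?W ^ 5"
    unfolding eval2_family N_def by (simp_all add: eval_nat_numeral algebra_simps)
  then have 2: "map_apply ?F ?G (point N 1) = point 0 1"
    using N W by (simp add: map point_eq_iff_det)
  show ?thesis
    unfolding three_cycle_def using 0 1 2 N W by (simp add: point_eq_iff_det algebra_simps)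
qed

text \<open>Coprime coordinates have minimal valuation 0 at every prime, and the determinant with
  (0, 1) is \<open>- x\<close>, whose sign does not affect multiplicities.\<close>

lemma delta_coprime:
  fixes x y :: int
  assumes p: "prime p" and "x \<noteq> 0" "y \<noteq> 0" "coprime x y"
  shows "delta p (point 0 1) (point (of_int x) (of_int y)) = int (multiplicity (int p) x)"
proof -
  have vp: "vp p (of_int n) = int (multiplicity (int p) n)" for n
    by (simp add: vp_def)
  have "\<not> int p dvd x \<or> \<not> int p dvd y"
    using p assms(4) coprime_common_divisor[of x y "int p"] by (auto simp: prime_nat_iff)
  then have "min_val p (of_int x, of_int y) = 0"
    using assms by (auto simp: min_val_def vp insert_Diff_if not_dvd_imp_multiplicity_0)
  moreover have "min_val p (0, 1) = 0"
    using vp[of 1] by (simp add: min_val_def insert_Diff_if)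
  moreover have "vp p (- of_int x) = int (multiplicity (int p) x)"
    using vp[of "- x"] multiplicity_normalize_right[of "int p" x]
      multiplicity_normalize_right[of "int p" "- x"]
    by (simp del: multiplicity_normalize_right)
  ultimately show ?thesis
    using delta_point[OF p, of 0 1 "of_int x" "of_int y"] assms by (simp add: point_eq_iff_det)
qed

text \<open>The product defining the ideal is the prime factorization of \<open>x\<close>; oddness
  ensures that excluding the prime 2 loses no factor.\<close>

lemma ideal_of_coprime:
  fixes x :: nat and y :: int
  assumes "odd x" "y \<noteq> 0" "coprime (int x) y"
  shows "ideal_of (point 0 1) (point (of_nat x) (of_int y)) = PIdl\<^bsub>R_S\<^esub> (of_nat x)"
proof -
  have x: "x \<noteq> 0" using assms(1) by (metis even_zero)
  have delta: "delta p (point 0 1) (point (of_nat x) (of_int y)) = int (multiplicity p x)"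
    if "prime p" for p
    using delta_coprime[OF that, of "int x" y] assms x by (simp add: multiplicity_def flip: of_nat_power)
  let ?Q = "point (of_nat x) (of_int y)"
  have "{p. prime p \<and> p \<noteq> 2 \<and> delta p (point 0 1) ?Q \<noteq> 0} = prime_factors x"
    using assms(1) x by (auto simp: delta prime_factors_multiplicity not_dvd_imp_multiplicity_0)
  then have "(\<Prod>p \<in> {p. prime p \<and> p \<noteq> 2 \<and> delta p (point 0 1) ?Q \<noteq> 0}.
      (of_nat p :: rat) powi delta p (point 0 1) ?Q)
      = (\<Prod>p\<in>prime_factors x. of_nat (p ^ multiplicity p x))"
  proof (rule prod.cong)
    fix p assume "p \<in> prime_factors x"
    then have "prime p" by auto
    then show "(of_nat p :: rat) powi delta p (point 0 1) ?Q = of_nat (p ^ multiplicity p x)"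
      by (simp add: delta)
  qed
  also have "\<dots> = of_nat (\<Prod>p\<in>prime_factors x. p ^ multiplicity p x)"
    by simp
  also have "(\<Prod>p\<in>prime_factors x. p ^ multiplicity p x) = x"
    by (rule prime_factorization_nat[symmetric]) (use x in simp)
  finally show ?thesis by (simp add: ideal_of_def)
qed

section \<open>Principal ideals of Z[1/2]\<close>

lemma cring_R_S: "cring R_S"
proof -
  let ?C = "{of_int a / 2 ^ n | (a :: int) (n :: nat). True} :: rat set"
  have add: "x + y \<in> ?C" if "x \<in> ?C" "y \<in> ?C" for x y
  proof -
    from that obtain a b and m n :: nat where "x = of_int a / 2 ^ m" "y = of_int b / 2 ^ n" by blast
    then have "x + y = of_int (a * 2 ^ n + b * 2 ^ m) / 2 ^ (m + n)"
      by (simp add: add_divide_distrib power_add)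
    then show ?thesis by blast
  qed
  have mult: "x * y \<in> ?C" if "x \<in> ?C" "y \<in> ?C" for x y
  proof -
    from that obtain a b and m n :: nat where "x = of_int a / 2 ^ m" "y = of_int b / 2 ^ n" by blast
    then have "x * y = of_int (a * b) / 2 ^ (m + n)"
      by (simp add: power_add)
    then show ?thesis by blast
  qed
  have int: "of_int a \<in> ?C" for a
    by (auto intro!: exI[of _ a] exI[of _ "0::nat"])
  have neg: "\<exists>y. (\<exists>b m. y = of_int b / 2 ^ m) \<and> y + of_int a / 2 ^ n = (0 :: rat)"
    for a :: int and n :: nat
    by (intro exI[of _ "of_int (- a) / 2 ^ n"] conjI) (blast, simp)
  show ?thesis
    unfolding R_S_def
    by (intro cringI abelian_groupI comm_monoidI)
      (use add mult int[of 0] int[of 1] neg in \<open>auto simp: algebra_simps\<close>)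
qed

text \<open>Clearing the denominator shows that \<open>n\<close> divides \<open>m\<close> times a
  power of 2, and an odd \<open>n\<close> is coprime to that power. Applied both ways, this
  separates the ideals of distinct odd numbers.\<close>

lemma PIdl_R_S_eqD:
  fixes m n :: nat
  assumes "PIdl\<^bsub>R_S\<^esub> (of_nat m) = PIdl\<^bsub>R_S\<^esub> (of_nat n)" "odd n"
  shows "n dvd m"
proof -
  have "of_nat m \<in> PIdl\<^bsub>R_S\<^esub> (of_nat m)"
    by (rule ring.cgenideal_self[OF cring.axioms(1)[OF cring_R_S]])
      (auto simp: R_S_def intro!: exI[of _ "int m"] exI[of _ "0::nat"])
  then obtain a :: int and k :: nat where "(of_nat m :: rat) = of_int a / 2 ^ k * of_nat n"
    unfolding assms(1) by (auto simp: cgenideal_def R_S_def)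
  then have "(of_int (int m * 2 ^ k) :: rat) = of_int (a * int n)"
    by (simp add: field_simps)
  then have "int n dvd int m * 2 ^ k"
    by (metis dvd_triv_right of_int_eq_iff)
  then have "int n dvd int m"
    using assms(2) by (simp add: coprime_dvd_mult_left_iff)
  then show ?thesis by simp
qed

section \<open>Infinitude of the ideals\<close>

theorem theorem2:
  shows "infinite {I. ideal I R_S \<and>
    (\<exists>F G P0 P1 P2. rational_map 4 F G \<and> good_reduction_outside_2 F G \<and>
       three_cycle F G P0 P1 P2 \<and> ideal_of P0 P1 = I)}"
proof -
  define N :: "nat \<Rightarrow> nat" where "N k = (2 ^ k)\<^sup>2 + 2 ^ k + 1" for k
  define J where "J k = PIdl\<^bsub>R_S\<^esub> (of_nat (N k))" for k
  \<comment> \<open>\<open>N k\<close> exceeds the even number w (w + 1) by 1; this includes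
    \<open>k = 0\<close>, where it is 3.\<close>
  have odd: "odd (N k)" for k
    by (simp add: N_def)
  have "inj J"
  proof (rule injI)
    fix i j assume "J i = J j"
    then have "N i = N j"
      unfolding J_def using PIdl_R_S_eqD[OF _ odd] by (metis dvd_antisym)
    moreover have "strict_mono N"
      by (intro strict_monoI) (simp add: N_def add_strict_mono power_strict_mono)
    ultimately show "i = j" by (simp add: strict_mono_eq)
  qed
  moreover have "ideal (J k) R_S \<and>
    (\<exists>F G P0 P1 P2. rational_map 4 F G \<and> good_reduction_outside_2 F G \<and>
       three_cycle F G P0 P1 P2 \<and> ideal_of P0 P1 = J k)" for k
  proof (intro conjI exI)
    let ?w = "2 ^ k :: int"
    let ?F = "homogenize 4 (numer ?w)" and ?G = "homogenize 4 (denom ?w)"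
    have N: "int (N k) = ?w * (?w + 1) + 1" "(of_nat (N k) :: rat) = (of_int ?w)\<^sup>2 + of_int ?w + 1"
      by (simp_all add: N_def power2_eq_square algebra_simps)
    show "ideal (J k) R_S"
      unfolding J_def
      by (rule cring.cgenideal_ideal[OF cring_R_S])
        (auto simp: R_S_def intro!: exI[of _ "int (N k)"] exI[of _ "0::nat"])
    show "rational_map 4 ?F ?G"
      by (simp add: rational_map_def homogeneous_homogenize coprime_family)
    show "good_reduction_outside_2 ?F ?G"
      unfolding good_reduction_outside_2_def
    proof safe
      fix p :: nat assume p: "prime p" "p \<noteq> 2"
      then have "\<not> int p dvd 2 ^ k"
        by (metis prime_dvd_power primes_dvd_imp_eq two_is_prime_nat prime_nat_int_transfer
            of_nat_numeral int_dvd_int_iff)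
      with p show "good_reduction p ?F ?G" by (intro good_reduction_family)
    qed
    show "three_cycle ?F ?G (point 0 1) (point (of_nat (N k)) (of_int (?w + 1))) (point (of_nat (N k)) 1)"
      using three_cycle_family[of ?w] unfolding N by simp
    \<comment> \<open>N = (w + 1) w + 1 leaves remainder 1.\<close>
    have "coprime (?w + 1) (int (N k))"
      by (rule coprime_add_multiple[of _ 1 _ ?w]) (simp_all add: N)
    then show "ideal_of (point 0 1) (point (of_nat (N k)) (of_int (?w + 1))) = J k"
      unfolding J_def using odd
      by (intro ideal_of_coprime) (auto simp: coprime_commute add_pos_pos less_imp_neq[symmetric])
  qed
  ultimately have "range J \<subseteq> {I. ideal I R_S \<and>
    (\<exists>F G P0 P1 P2. rational_map 4 F G \<and> good_reduction_outside_2 F G \<and>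
       three_cycle F G P0 P1 P2 \<and> ideal_of P0 P1 = I)}" "infinite (range J)"
    by (auto simp: range_inj_infinite)
  then show ?thesis using infinite_super by blast
qed

end
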